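(* Let $G$ be a compact group, and suppose that the free left-translation action of $G$ on $\prod_{\rho}U(\dim\rho)$ through the canonical embedding $$\mathrm{can}_G=\prod_\rho \rho: G\hookrightarrow \prod_{\rho}U(\dim \rho)$$ is principal (this is so, in particular, if every free continuous action of $G$ on a Tychonoff space is principal). Then: - the connected-component group $G/G_0$ and the group $\pi_0(G)$ of path components of $G$ are both finite, and they coincide; - $G_0$ is path-connected; - $G$ and $G_0$ are locally connected and locally path-connected.
   Context: Compact groups are compact Hausdorff topological groups; $G_0$ is the identity connected component of $G$. The product is over (representatives of the isomorphism classes of) irreducible unitary representations $\rho: G\to U(\dim\rho)$ of $G$, and $U(n)$ is the group of $n\times n$ unitary matrices. A free continuous action of $G$ on a Tychonoff space $X$ is principal if $X\to X/G$ is a locally trivial principal $G$-bundle, i.e. every point of $X/G$ has an open neighborhood $U$ whose preimage in $X$ is $G$-equivariantly homeomorphic over $U$ to $G\times U$. A space is locally (path-)connected if its topology has a basis of (path-)connected open sets. *)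

theory Defs
  imports
    "HOL-Analysis.Urysohn"
    "HOL-Algebra.Product_Groups"
    "HOL-Algebra.Group_Action"
    "Jordan_Normal_Form.Schur_Decomposition"
begin

definition topological_group :: "('a, 'm) monoid_scheme \<Rightarrow> 'a topology \<Rightarrow> bool" where
  "topological_group G T \<longleftrightarrow>
     group G \<and> topspace T = carrier G \<and>
     continuous_map (prod_topology T T) T (\<lambda>(x, y). x \<otimes>\<^bsub>G\<^esub> y) \<and>
     continuous_map T T (\<lambda>x. inv\<^bsub>G\<^esub> x)"

definition compact_group :: "('a, 'm) monoid_scheme \<Rightarrow> 'a topology \<Rightarrow> bool" where
  "compact_group G T \<longleftrightarrow> topological_group G T \<and> compact_space T \<and> Hausdorff_space T"

definition identity_component :: "('a, 'm) monoid_scheme \<Rightarrow> 'a topology \<Rightarrow> 'a set" where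
  "identity_component G T = connected_component_of_set T \<one>\<^bsub>G\<^esub>"

text \<open>In a topological group the setwise product of the path components of \<open>x\<close> and \<open>y\<close> is the
  path component of \<open>x \<otimes> y\<close>, so this is the usual group structure on path components.\<close>

definition pi0_group :: "('a, 'm) monoid_scheme \<Rightarrow> 'a topology \<Rightarrow> 'a set monoid" where
  "pi0_group G T =
     \<lparr>carrier = path_components_of T, mult = set_mult G,
      one = path_component_of_set T \<one>\<^bsub>G\<^esub>\<rparr>"


subsection \<open>Free and principal actions\<close>

definition continuous_action ::
    "('a, 'm) monoid_scheme \<Rightarrow> 'a topology \<Rightarrow> 'x topology \<Rightarrow> ('a \<Rightarrow> 'x \<Rightarrow> 'x) \<Rightarrow> bool" where
  "continuous_action G T X \<phi> \<longleftrightarrow>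
     group_action G (topspace X) \<phi> \<and>
     continuous_map (prod_topology T X) X (\<lambda>(g, x). \<phi> g x)"

definition free_action ::
    "('a, 'm) monoid_scheme \<Rightarrow> 'x topology \<Rightarrow> ('a \<Rightarrow> 'x \<Rightarrow> 'x) \<Rightarrow> bool" where
  "free_action G X \<phi> \<longleftrightarrow> (\<forall>x\<in>topspace X. stabilizer G \<phi> x = {\<one>\<^bsub>G\<^esub>})"

definition orbit_space ::
    "('a, 'm) monoid_scheme \<Rightarrow> 'x topology \<Rightarrow> ('a \<Rightarrow> 'x \<Rightarrow> 'x) \<Rightarrow> 'x set topology" where
  "orbit_space G X \<phi> =
     topology (\<lambda>U. U \<subseteq> orbits G (topspace X) \<phi> \<and>
                   openin X {x \<in> topspace X. orbit G \<phi> x \<in> U})"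

lemma openin_orbit_space:
  "openin (orbit_space G X \<phi>) U \<longleftrightarrow>
     U \<subseteq> orbits G (topspace X) \<phi> \<and> openin X {x \<in> topspace X. orbit G \<phi> x \<in> U}"
proof -
  let ?P = "\<lambda>U. U \<subseteq> orbits G (topspace X) \<phi> \<and> openin X {x \<in> topspace X. orbit G \<phi> x \<in> U}"
  have "?P (S \<inter> S')" if "?P S" "?P S'" for S S'
  proof -
    have "{x \<in> topspace X. orbit G \<phi> x \<in> S \<inter> S'} =
          {x \<in> topspace X. orbit G \<phi> x \<in> S} \<inter> {x \<in> topspace X. orbit G \<phi> x \<in> S'}"
      by auto
    then show ?thesis using that by auto
  qed
  moreover have "?P (\<Union>K)" if "\<forall>S\<in>K. ?P S" for K
  proof -
    have "{x \<in> topspace X. orbit G \<phi> x \<in> \<Union>K} = (\<Union>S\<in>K. {x \<in> topspace X. orbit G \<phi> x \<in> S})"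
      by auto
    then show ?thesis using that by (auto intro!: openin_Union)
  qed
  ultimately have "istopology ?P"
    unfolding istopology_def by blast
  then show ?thesis
    unfolding orbit_space_def by (simp add: topology_inverse')
qed

definition locally_trivial_action ::
    "('a, 'm) monoid_scheme \<Rightarrow> 'a topology \<Rightarrow> 'x topology \<Rightarrow> ('a \<Rightarrow> 'x \<Rightarrow> 'x) \<Rightarrow> bool" where
  "locally_trivial_action G T X \<phi> \<longleftrightarrow>
     (\<forall>q \<in> topspace (orbit_space G X \<phi>).
        \<exists>U. openin (orbit_space G X \<phi>) U \<and> q \<in> U \<and>
          (let V = {x \<in> topspace X. orbit G \<phi> x \<in> U} in
           \<exists>h. homeomorphic_map (subtopology X V)
                  (prod_topology T (subtopology (orbit_space G X \<phi>) U)) h \<and>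
               (\<forall>x\<in>V. snd (h x) = orbit G \<phi> x) \<and>
               (\<forall>g\<in>carrier G. \<forall>x\<in>V. h (\<phi> g x) = (g \<otimes>\<^bsub>G\<^esub> fst (h x), snd (h x)))))"

definition principal_action ::
    "('a, 'm) monoid_scheme \<Rightarrow> 'a topology \<Rightarrow> 'x topology \<Rightarrow> ('a \<Rightarrow> 'x \<Rightarrow> 'x) \<Rightarrow> bool" where
  "principal_action G T X \<phi> \<longleftrightarrow>
     continuous_action G T X \<phi> \<and> free_action G X \<phi> \<and> locally_trivial_action G T X \<phi>"

definition Tychonoff_space :: "'x topology \<Rightarrow> bool" where
  "Tychonoff_space X \<longleftrightarrow> completely_regular_space X \<and> Hausdorff_space X"


subsection \<open>Unitary groups and irreducible unitary representations\<close>

definition unitary_group :: "nat \<Rightarrow> complex mat monoid" where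
  "unitary_group n =
     \<lparr>carrier = {A \<in> carrier_mat n n. A * mat_adjoint A = 1\<^sub>m n \<and> mat_adjoint A * A = 1\<^sub>m n},
      mult = (*), one = 1\<^sub>m n\<rparr>"

text \<open>The topology of \<open>U(n)\<close> as a subspace of the \<open>n \<times> n\<close> complex matrices, i.e. of
  \<open>\<complex>\<close> to the power \<open>n * n\<close> via the matrix entries.\<close>

definition unitary_topology :: "nat \<Rightarrow> complex mat topology" where
  "unitary_topology n =
     pullback_topology (carrier (unitary_group n))
       (\<lambda>A. \<lambda>ij\<in>{..<n} \<times> {..<n}. A $$ ij)
       (product_topology (\<lambda>_. euclidean) ({..<n} \<times> {..<n}))"

text \<open>A unitary representation \<open>G \<rightarrow> U(n)\<close> is encoded as the pair of its dimension \<open>n\<close> and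
  the map itself; only the values of the map on the carrier of \<open>G\<close> matter.\<close>

type_synonym 'a unitary_rep = "nat \<times> ('a \<Rightarrow> complex mat)"

definition unitary_representation ::
    "('a, 'm) monoid_scheme \<Rightarrow> 'a topology \<Rightarrow> 'a unitary_rep \<Rightarrow> bool" where
  "unitary_representation G T = (\<lambda>(n, \<rho>).
     \<rho> \<in> hom G (unitary_group n) \<and> continuous_map T (unitary_topology n) \<rho>)"

definition invariant_subspace ::
    "('a, 'm) monoid_scheme \<Rightarrow> 'a unitary_rep \<Rightarrow> complex Matrix.vec set \<Rightarrow> bool" where
  "invariant_subspace G = (\<lambda>(n, \<rho>) W.
     W \<subseteq> carrier_vec n \<and> 0\<^sub>v n \<in> W \<and>
     (\<forall>v\<in>W. \<forall>w\<in>W. v + w \<in> W) \<and> (\<forall>c. \<forall>v\<in>W. c \<cdot>\<^sub>v v \<in> W) \<and>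
     (\<forall>g\<in>carrier G. \<forall>v\<in>W. \<rho> g *\<^sub>v v \<in> W))"

definition irreducible_unitary_representation ::
    "('a, 'm) monoid_scheme \<Rightarrow> 'a topology \<Rightarrow> 'a unitary_rep \<Rightarrow> bool" where
  "irreducible_unitary_representation G T r \<longleftrightarrow>
     unitary_representation G T r \<and> fst r > 0 \<and>
     (\<forall>W. invariant_subspace G r W \<longrightarrow> W = {0\<^sub>v (fst r)} \<or> W = carrier_vec (fst r))"

definition isomorphic_unitary_reps ::
    "('a, 'm) monoid_scheme \<Rightarrow> 'a unitary_rep \<Rightarrow> 'a unitary_rep \<Rightarrow> bool" where
  "isomorphic_unitary_reps G = (\<lambda>(n, \<rho>) (m, \<sigma>).
     n = m \<and> (\<exists>A \<in> carrier (unitary_group n). \<forall>g\<in>carrier G. A * \<rho> g = \<sigma> g * A))"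

definition irrep_representatives ::
    "('a, 'm) monoid_scheme \<Rightarrow> 'a topology \<Rightarrow> 'a unitary_rep set \<Rightarrow> bool" where
  "irrep_representatives G T R \<longleftrightarrow>
     (\<forall>r\<in>R. irreducible_unitary_representation G T r) \<and>
     (\<forall>r. irreducible_unitary_representation G T r \<longrightarrow>
          (\<exists>!s. s \<in> R \<and> isomorphic_unitary_reps G r s))"


subsection \<open>The canonical embedding\<close>

definition unitary_product_group ::
    "'a unitary_rep set \<Rightarrow> ('a unitary_rep \<Rightarrow> complex mat) monoid" where
  "unitary_product_group R = product_group R (\<lambda>r. unitary_group (fst r))"

definition unitary_product_topology ::
    "'a unitary_rep set \<Rightarrow> ('a unitary_rep \<Rightarrow> complex mat) topology" where
  "unitary_product_topology R = product_topology (\<lambda>r. unitary_topology (fst r)) R"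

definition can_map :: "'a unitary_rep set \<Rightarrow> 'a \<Rightarrow> 'a unitary_rep \<Rightarrow> complex mat" where
  "can_map R g = (\<lambda>r\<in>R. snd r g)"

text \<open>Library group actions consist of maps that are extensional on the space acted upon, whence
  the restriction.\<close>

definition can_action ::
    "'a unitary_rep set \<Rightarrow> 'a \<Rightarrow>
     ('a unitary_rep \<Rightarrow> complex mat) \<Rightarrow> ('a unitary_rep \<Rightarrow> complex mat)" where
  "can_action R g =
     (\<lambda>x \<in> topspace (unitary_product_topology R). can_map R g \<otimes>\<^bsub>unitary_product_group R\<^esub> x)"

end

theory Submission
  imports Defs "Jordan_Normal_Form.Spectral_Radius"
begin

text \<open>Each \<open>U(n)\<close> is path-connected and locally path-connected: by the spectral theorem every
  \<open>B\<close> is joined to \<open>A\<close> by a path that stays inside any Frobenius ball around \<open>A\<close> containing \<open>B\<close>.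
  Hence the product of the unitary groups is locally path-connected. If the translation action is
  principal, a nonempty open subset of that product is homeomorphic to \<open>G \<times> U\<close>, so \<open>G\<close> is locally
  path-connected. Its components are then open and equal to the path components, and by compactness
  there are finitely many of them.\<close>

subsection \<open>Diagonalization of unitary matrices\<close>

text \<open>The index set \<open>R\<close> may be infinite, and a nonempty product of infinitely
  many spaces is locally path-connected only if all but finitely many factors are also
  path-connected. This is why both properties of U(n) are needed; one path construction yields both.
  The path from A to B comes from a logarithm of \<open>mat_adjoint A * B\<close>, obtained by
  diagonalization. Such a logarithm does not depend continuously on B near eigenvalue -1, but this
  does no harm: each B gets its own path, and only the distance of that path from A has to be
  controlled. Nothing is known about the orbit space, so a chart G x U is useful only through its
  factor G. A factor of a nonempty locally path-connected product is itself locally path-connected,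
  because projections are continuous open surjections.\<close>

lemma dim_mat_adjoint [simp]:
  "dim_row (mat_adjoint A) = dim_col A" "dim_col (mat_adjoint A) = dim_row A"
  by (simp_all add: mat_adjoint_def)

lemma mat_adjoint_carrier [simp]:
  "A \<in> carrier_mat n m \<Longrightarrow> mat_adjoint A \<in> carrier_mat m n"
  by (intro carrier_matI) simp_all

lemma index_mat_adjoint [simp]:
  "i < dim_col A \<Longrightarrow> j < dim_row A \<Longrightarrow> mat_adjoint A $$ (i, j) = conjugate (A $$ (j, i))"
  by (simp add: mat_adjoint_def mat_of_rows_def)

lemma mat_adjoint_adjoint [simp]: "mat_adjoint (mat_adjoint A) = A"
  by (rule eq_matI) auto

lemma mat_adjoint_one [simp]: "mat_adjoint (1\<^sub>m n :: complex mat) = 1\<^sub>m n"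
  by (rule eq_matI) auto

lemma index_mult_mat_sum:
  assumes "A \<in> carrier_mat n m" "B \<in> carrier_mat m k" "i < n" "j < k"
  shows "(A * B) $$ (i, j) = (\<Sum>l<m. A $$ (i, l) * B $$ (l, j))"
  using assms by (simp add: scalar_prod_def atLeast0LessThan)

lemma mat_adjoint_mult:
  fixes A B :: "complex mat"
  assumes A: "A \<in> carrier_mat n m" and B: "B \<in> carrier_mat m k"
  shows "mat_adjoint (A * B) = mat_adjoint B * mat_adjoint A"
proof (rule eq_matI)
  fix i j assume ij: "i < dim_row (mat_adjoint B * mat_adjoint A)" "j < dim_col (mat_adjoint B * mat_adjoint A)"
  then have "i < k" "j < n" using A B by auto
  then show "mat_adjoint (A * B) $$ (i, j) = (mat_adjoint B * mat_adjoint A) $$ (i, j)"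
    using A B index_mult_mat_sum[OF A B \<open>j < n\<close> \<open>i < k\<close>]
      index_mult_mat_sum[OF mat_adjoint_carrier[OF B] mat_adjoint_carrier[OF A] \<open>i < k\<close> \<open>j < n\<close>]
    by (simp add: mult.commute del: index_mult_mat(1))
qed (use A B in auto)

lemma unitary_group_simps:
  "mult (unitary_group n) = (*)" "one (unitary_group n) = 1\<^sub>m n"
  by (simp_all add: unitary_group_def)

lemma unitary_carrier: "A \<in> carrier (unitary_group n) \<Longrightarrow> A \<in> carrier_mat n n"
  and unitary_mult_adjoint: "A \<in> carrier (unitary_group n) \<Longrightarrow> A * mat_adjoint A = 1\<^sub>m n"
  and unitary_adjoint_mult: "A \<in> carrier (unitary_group n) \<Longrightarrow> mat_adjoint A * A = 1\<^sub>m n"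
  by (simp_all add: unitary_group_def)

lemma unitaryI:
  assumes "A \<in> carrier_mat n n" "A * mat_adjoint A = 1\<^sub>m n"
  shows "A \<in> carrier (unitary_group n)"
  using assms mat_mult_left_right_inverse[of A n "mat_adjoint A"] by (simp add: unitary_group_def)

lemma unitary_one: "1\<^sub>m n \<in> carrier (unitary_group n)"
  by (simp add: unitary_group_def)

lemma unitary_adjoint: "A \<in> carrier (unitary_group n) \<Longrightarrow> mat_adjoint A \<in> carrier (unitary_group n)"
  by (simp add: unitary_group_def)

lemma unitary_mult:
  assumes A: "A \<in> carrier (unitary_group n)" and B: "B \<in> carrier (unitary_group n)"
  shows "A * B \<in> carrier (unitary_group n)"
proof (rule unitaryI)
  note c = unitary_carrier[OF A] unitary_carrier[OF B]
  show "A * B \<in> carrier_mat n n" using c by auto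
  have "A * B * mat_adjoint (A * B) = A * (B * mat_adjoint B) * mat_adjoint A"
    using c by (simp add: mat_adjoint_mult[OF c] assoc_mult_mat[of _ n n _ n _ n] mult_carrier_mat[of _ n n _ n])
  then show "A * B * mat_adjoint (A * B) = 1\<^sub>m n"
    using c unitary_mult_adjoint[OF A] unitary_mult_adjoint[OF B] by simp
qed

lemma group_unitary_group: "group (unitary_group n)"
proof (rule groupI, unfold unitary_group_simps)
  fix A B C assume A: "A \<in> carrier (unitary_group n)"
  show "\<exists>B\<in>carrier (unitary_group n). B * A = 1\<^sub>m n"
    using unitary_adjoint[OF A] unitary_adjoint_mult[OF A] by blast
  show "1\<^sub>m n * A = A"
    using unitary_carrier[OF A] by simp
  assume B: "B \<in> carrier (unitary_group n)"
  show "A * B \<in> carrier (unitary_group n)"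
    by (rule unitary_mult[OF A B])
  assume C: "C \<in> carrier (unitary_group n)"
  show "A * B * C = A * (B * C)"
    by (rule assoc_mult_mat[OF A[THEN unitary_carrier] B[THEN unitary_carrier] C[THEN unitary_carrier]])
qed (rule unitary_one)

lemma unitary_rows:
  assumes "A \<in> carrier (unitary_group n)" "i < n" "j < n"
  shows "(\<Sum>k<n. A $$ (i, k) * cnj (A $$ (j, k))) = (if i = j then 1 else 0)"
proof -
  have "(A * mat_adjoint A) $$ (i, j) = (if i = j then 1 else 0)"
    using unitary_mult_adjoint[OF assms(1)] assms by simp
  then show ?thesis
    using assms unitary_carrier[OF assms(1)]
    by (subst (asm) index_mult_mat_sum[of _ n n _ n]) (auto simp: conjugate_complex_def)
qed

lemma unitary_cols:
  assumes "A \<in> carrier (unitary_group n)" "i < n" "j < n"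
  shows "(\<Sum>k<n. cnj (A $$ (k, i)) * A $$ (k, j)) = (if i = j then 1 else 0)"
proof -
  have "(mat_adjoint A * A) $$ (i, j) = (if i = j then 1 else 0)"
    using unitary_adjoint_mult[OF assms(1)] assms by simp
  then show ?thesis
    using assms unitary_carrier[OF assms(1)]
    by (subst (asm) index_mult_mat_sum[of _ n n _ n]) (auto simp: conjugate_complex_def)
qed

lemma unitary_if_orthonormal_rows:
  assumes A: "A \<in> carrier_mat n n"
    and "\<And>i j. i < n \<Longrightarrow> j < n \<Longrightarrow> (\<Sum>k<n. A $$ (i, k) * cnj (A $$ (j, k))) = (if i = j then 1 else 0)"
  shows "A \<in> carrier (unitary_group n)"
proof (rule unitaryI[OF A], rule eq_matI)
  fix i j assume "i < dim_row (1\<^sub>m n)" "j < dim_col (1\<^sub>m n)"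
  then show "(A * mat_adjoint A) $$ (i, j) = 1\<^sub>m n $$ (i, j)"
    using assms by (subst index_mult_mat_sum[of _ n n _ n]) (auto simp: conjugate_complex_def)
qed (use A in auto)

lemma unitary_if_orthonormal_cols:
  assumes A: "A \<in> carrier_mat n n"
    and "\<And>i j. i < n \<Longrightarrow> j < n \<Longrightarrow> (\<Sum>k<n. cnj (A $$ (k, i)) * A $$ (k, j)) = (if i = j then 1 else 0)"
  shows "A \<in> carrier (unitary_group n)"
proof -
  have "mat_adjoint A \<in> carrier (unitary_group n)"
    using assms
    by (intro unitary_if_orthonormal_rows) (auto simp: conjugate_complex_def)
  then show ?thesis using unitary_adjoint by fastforce
qed

text \<open>Complete \<open>v\<close> to a basis, orthogonalize, and normalize. Applied to an
  eigenvector, the resulting \<open>W\<close> is the change of basis that splits the eigenvector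
  off.\<close>

lemma unitary_with_first_col:
  fixes v :: "complex Matrix.vec"
  assumes v: "v \<in> carrier_vec n" and v0: "v \<noteq> 0\<^sub>v n"
  obtains W c where "W \<in> carrier (unitary_group n)" "col W 0 = c \<cdot>\<^sub>v v"
proof -
  have "n \<noteq> 0"
    using v v0 by (intro notI) (auto intro: eq_vecI)
  define b where "b = basis_completion v"
  define ws where "ws = gram_schmidt n b"
  interpret cof_vec_space n "TYPE(complex)" .
  note bc = basis_completion[OF v v0, folded b_def]
  obtain vs where bv: "b = v # vs" using bc(6,7) \<open>n \<noteq> 0\<close> by (cases b) auto
  have ws: "set ws \<subseteq> carrier_vec n" "corthogonal ws" "length ws = n"
    using gram_schmidt_result[OF bc(2,4,5) refl, folded ws_def] bc(6) by auto
  \<comment> \<open>Gram-Schmidt subtracts nothing from the first vector of its input.\<close>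
  have "hd ws = v"
    using gram_schmidt_hd[OF v, of vs, folded bv] unfolding ws_def .
  then have w0: "ws ! 0 = v" using ws(3) \<open>n \<noteq> 0\<close> by (cases ws) auto
  have dim: "dim_vec (ws ! j) = n" if "j < n" for j
    using ws that by (metis carrier_vecD nth_mem subsetD)
  define r where "r j = sqrt (\<Sum>k<n. (cmod (ws ! j $ k))\<^sup>2)" for j
  have ip: "(\<Sum>k<n. ws ! i $ k * cnj (ws ! j $ k)) = (if i = j then of_real ((r i)\<^sup>2) else 0)"
    if "i < n" "j < n" for i j
  proof (cases "i = j")
    case True
    have "(r j)\<^sup>2 = (\<Sum>k<n. (cmod (ws ! j $ k))\<^sup>2)"
      unfolding r_def by (simp add: sum_nonneg)
    then have "complex_of_real ((r j)\<^sup>2) = (\<Sum>k<n. ws ! j $ k * cnj (ws ! j $ k))"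
      by (simp only: of_real_sum complex_norm_square)
    then show ?thesis using True by simp
  next
    case False
    then have "ws ! i \<bullet>c ws ! j = 0" using corthogonalD[OF ws(2)] that ws(3) by auto
    then show ?thesis using False dim that
      by (simp add: scalar_prod_def conjugate_complex_def atLeast0LessThan)
  qed
  have r: "r i \<noteq> 0" if "i < n" for i
  proof
    assume "r i = 0"
    then have "(\<Sum>k<n. ws ! i $ k * cnj (ws ! i $ k)) = 0" using ip[OF that that] by simp
    then have "ws ! i \<bullet>c ws ! i = 0" using dim that
      by (simp add: scalar_prod_def conjugate_complex_def atLeast0LessThan)
    then show False using corthogonalD[OF ws(2), of i i] that ws(3) by auto
  qed
  \<comment> \<open>\<open>gram_schmidt\<close> only makes the vectors orthogonal; dividing by the
    lengths \<open>r j\<close> makes the columns orthonormal.\<close>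
  define W where "W = mat n n (\<lambda>(k, j). ws ! j $ k / of_real (r j))"
  have "W \<in> carrier (unitary_group n)"
  proof (rule unitary_if_orthonormal_cols)
    fix i j assume ij: "i < n" "j < n"
    have "(\<Sum>k<n. cnj (W $$ (k, i)) * W $$ (k, j)) =
        (\<Sum>k<n. ws ! j $ k * cnj (ws ! i $ k)) / (of_real (r i) * of_real (r j))"
      unfolding sum_divide_distrib using ij by (intro sum.cong) (auto simp: W_def)
    also have "\<dots> = (if i = j then 1 else 0)"
      using ip[of j i] ij r[of i] by (auto simp: power2_eq_square)
    finally show "(\<Sum>k<n. cnj (W $$ (k, i)) * W $$ (k, j)) = (if i = j then 1 else 0)" .
  qed (simp add: W_def)
  moreover have "col W 0 = (1 / of_real (r 0)) \<cdot>\<^sub>v v"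
    using v \<open>n \<noteq> 0\<close> by (intro eq_vecI) (auto simp: W_def w0)
  ultimately show ?thesis using that by blast
qed

definition diag_of :: "nat \<Rightarrow> (nat \<Rightarrow> complex) \<Rightarrow> complex mat" where
  "diag_of n d = mat n n (\<lambda>(i, j). if i = j then d i else 0)"

lemma diag_of_carrier [simp]: "diag_of n d \<in> carrier_mat n n"
  by (simp add: diag_of_def)

lemma index_conj_diag:
  assumes P: "P \<in> carrier_mat n n" and "i < n" "j < n"
  shows "(P * diag_of n d * mat_adjoint P) $$ (i, j) = (\<Sum>k<n. P $$ (i, k) * d k * cnj (P $$ (j, k)))"
proof -
  have "(P * diag_of n d) $$ (i, k) = P $$ (i, k) * d k" if "k < n" for k
    using assms that
    by (subst index_mult_mat_sum[of _ n n _ n])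
       (auto simp: diag_of_def if_distrib[of "\<lambda>x. _ * x"] cong: if_cong)
  then show ?thesis
    using assms by (subst index_mult_mat_sum[of _ n n _ n]) (auto simp: conjugate_complex_def)
qed

text \<open>Induction by deflation: conjugating by a unitary matrix whose first column is an
  eigenvector clears the rest of the first column. Unitarity then clears the rest of the first row
  as well, so a unitary block of size \<open>n\<close> remains for the induction hypothesis.\<close>

theorem unitary_diagonalizable:
  assumes "A \<in> carrier (unitary_group n)"
  shows "\<exists>P\<in>carrier (unitary_group n). \<exists>d. (\<forall>k<n. cmod (d k) = 1) \<and> A = P * diag_of n d * mat_adjoint P"
  using assms
proof (induction n arbitrary: A)
  case 0
  then have "A = 1\<^sub>m 0 * diag_of 0 (\<lambda>_. 1) * mat_adjoint (1\<^sub>m 0)"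
    using unitary_carrier[OF 0] by (intro eq_matI) auto
  then show ?case using unitary_one by blast
next
  case (Suc n)
  let ?n = "Suc n"
  note A = Suc.prems and Ac = unitary_carrier[OF Suc.prems]
  obtain e where "eigenvalue A e"
    using spectrum_non_empty[OF Ac] by (auto simp: spectrum_def)
  then obtain v where v: "v \<in> carrier_vec ?n" "v \<noteq> 0\<^sub>v ?n" "A *\<^sub>v v = e \<cdot>\<^sub>v v"
    using Ac by (auto simp: eigenvalue_def eigenvector_def)
  obtain W c where W: "W \<in> carrier (unitary_group ?n)" and colW: "col W 0 = c \<cdot>\<^sub>v v"
    using unitary_with_first_col[OF v(1,2)] by blast
  note Wc = unitary_carrier[OF W]
  define A' where "A' = mat_adjoint W * A * W"
  have A': "A' \<in> carrier (unitary_group ?n)"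
    unfolding A'_def by (intro unitary_mult unitary_adjoint A W)
  note A'c = unitary_carrier[OF A']
  have A_eq: "A = W * A' * mat_adjoint W"
  proof -
    have "W * A' * mat_adjoint W = (W * mat_adjoint W) * A * (W * mat_adjoint W)"
      unfolding A'_def using Wc Ac by (simp add: assoc_mult_mat[of _ ?n ?n _ ?n _ ?n] mult_carrier_mat[of _ ?n ?n _ ?n])
    then show ?thesis using unitary_mult_adjoint[OF W] Ac by simp
  qed
  have "A' = mat_adjoint W * (A * W)"
    unfolding A'_def using Wc Ac by (intro assoc_mult_mat) auto
  then have "col A' 0 = mat_adjoint W *\<^sub>v col (A * W) 0"
    using col_mult2[OF mat_adjoint_carrier[OF Wc] mult_carrier_mat[OF Ac Wc]] by simp
  also have "col (A * W) 0 = A *\<^sub>v col W 0"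
    by (rule col_mult2[OF Ac Wc]) simp
  also have "A *\<^sub>v col W 0 = e \<cdot>\<^sub>v col W 0"
    unfolding colW mult_mat_vec[OF Ac v(1)] v(3)
    by (simp only: smult_smult_assoc mult.commute)
  also have "mat_adjoint W *\<^sub>v (e \<cdot>\<^sub>v col W 0) = e \<cdot>\<^sub>v (mat_adjoint W *\<^sub>v col W 0)"
    by (rule mult_mat_vec[OF mat_adjoint_carrier[OF Wc]]) (use colW v in simp)
  also have "mat_adjoint W *\<^sub>v col W 0 = col (mat_adjoint W * W) 0"
    by (rule col_mult2[OF mat_adjoint_carrier[OF Wc] Wc, symmetric]) simp
  finally have col: "col A' 0 = e \<cdot>\<^sub>v unit_vec ?n 0"
    using unitary_adjoint_mult[OF W] by simp
  have col0: "A' $$ (i, 0) = (if i = 0 then e else 0)" if "i < ?n" for i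
  proof -
    have "A' $$ (i, 0) = col A' 0 $ i" using A'c that by simp
    then show ?thesis unfolding col using that by simp
  qed
  have "(\<Sum>k<?n. cnj (A' $$ (k, 0)) * A' $$ (k, 0)) = 1"
    using unitary_cols[OF A', of 0 0] by simp
  then have "cnj e * e = 1" by (simp add: col0 sum.lessThan_Suc_shift del: sum.lessThan_Suc)
  then have "complex_of_real ((cmod e)\<^sup>2) = of_real 1"
    unfolding complex_norm_square by (simp add: mult.commute)
  then have "(cmod e)\<^sup>2 = 1" by (simp only: of_real_eq_iff)
  then have e: "cmod e = 1" using norm_ge_zero[of e] by (auto simp: power2_eq_1_iff)
  \<comment> \<open>The first row has length 1 and its first entry \<open>e\<close> already has
    modulus 1, which leaves nothing for the other entries.\<close>
  have "(\<Sum>k<?n. A' $$ (0, k) * cnj (A' $$ (0, k))) = 1"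
    using unitary_rows[OF A', of 0 0] by simp
  then have "complex_of_real (\<Sum>k<?n. (cmod (A' $$ (0, k)))\<^sup>2) = of_real 1"
    by (simp only: of_real_sum complex_norm_square of_real_1)
  then have "(\<Sum>k<?n. (cmod (A' $$ (0, k)))\<^sup>2) = 1" by (simp only: of_real_eq_iff)
  then have "(\<Sum>k<n. (cmod (A' $$ (0, Suc k)))\<^sup>2) = 0"
    using col0[of 0] e by (simp add: sum.lessThan_Suc_shift del: sum.lessThan_Suc)
  then have row0: "A' $$ (0, Suc k) = 0" if "k < n" for k
    using that by (subst (asm) sum_nonneg_eq_0_iff) auto
  define B where "B = mat n n (\<lambda>(i, j). A' $$ (Suc i, Suc j))"
  have "B \<in> carrier (unitary_group n)"
  proof (rule unitary_if_orthonormal_rows)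
    fix i j assume "i < n" "j < n"
    then show "(\<Sum>k<n. B $$ (i, k) * cnj (B $$ (j, k))) = (if i = j then 1 else 0)"
      using unitary_rows[OF A', of "Suc i" "Suc j"]
      by (simp add: B_def col0 sum.lessThan_Suc_shift del: sum.lessThan_Suc)
  qed (simp add: B_def)
  then obtain Q d where Q: "Q \<in> carrier (unitary_group n)" and d: "\<forall>k<n. cmod (d k) = 1"
    and B: "B = Q * diag_of n d * mat_adjoint Q"
    using Suc.IH by blast
  note Qc = unitary_carrier[OF Q]
  \<comment> \<open>\<open>P\<close> is the block sum of the 1 x 1 identity and \<open>Q\<close>;
    likewise \<open>d'\<close> puts \<open>e\<close> in front of \<open>d\<close>.\<close>
  define P where "P = mat ?n ?n (\<lambda>(i, j). case i of 0 \<Rightarrow> (if j = 0 then 1 else 0)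
     | Suc i' \<Rightarrow> (case j of 0 \<Rightarrow> 0 | Suc j' \<Rightarrow> Q $$ (i', j')))"
  define d' where "d' k = (case k of 0 \<Rightarrow> e | Suc k' \<Rightarrow> d k')" for k
  have P_simps: "P $$ (0, 0) = 1" "k < n \<Longrightarrow> P $$ (0, Suc k) = 0" "k < n \<Longrightarrow> P $$ (Suc k, 0) = 0"
    "k < n \<Longrightarrow> l < n \<Longrightarrow> P $$ (Suc k, Suc l) = Q $$ (k, l)" for k l
    by (simp_all add: P_def)
  have Pc: "P \<in> carrier_mat ?n ?n" by (simp add: P_def)
  have P: "P \<in> carrier (unitary_group ?n)"
  proof (rule unitary_if_orthonormal_rows[OF Pc])
    fix i j assume ij: "i < ?n" "j < ?n"
    show "(\<Sum>k<?n. P $$ (i, k) * cnj (P $$ (j, k))) = (if i = j then 1 else 0)"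
      using ij unitary_rows[OF Q]
      by (cases i; cases j) (simp_all add: P_simps sum.lessThan_Suc_shift del: sum.lessThan_Suc)
  qed
  have A'_eq: "A' = P * diag_of ?n d' * mat_adjoint P"
  proof (rule eq_matI)
    fix i j assume "i < dim_row (P * diag_of ?n d' * mat_adjoint P)"
      and "j < dim_col (P * diag_of ?n d' * mat_adjoint P)"
    then have ij: "i < ?n" "j < ?n" using Pc by auto
    have BQ: "A' $$ (Suc a, Suc b) = (\<Sum>k<n. Q $$ (a, k) * d k * cnj (Q $$ (b, k)))"
      if "a < n" "b < n" for a b
    proof -
      have "A' $$ (Suc a, Suc b) = B $$ (a, b)" using that by (simp add: B_def)
      then show ?thesis using index_conj_diag[OF Qc that] B by simp
    qed
    show "A' $$ (i, j) = (P * diag_of ?n d' * mat_adjoint P) $$ (i, j)"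
      unfolding index_conj_diag[OF Pc ij]
      using ij
      by (cases i; cases j)
         (simp_all add: P_simps d'_def col0 row0 BQ sum.lessThan_Suc_shift del: sum.lessThan_Suc)
  qed (use Pc A'c in auto)
  have "A = (W * P) * diag_of ?n d' * mat_adjoint (W * P)"
    unfolding A_eq A'_eq mat_adjoint_mult[OF Wc Pc]
    using Wc Pc by (simp add: assoc_mult_mat[of _ ?n ?n _ ?n _ ?n] mult_carrier_mat[of _ ?n ?n _ ?n])
  moreover have "\<forall>k<?n. cmod (d' k) = 1"
    using d e by (auto simp: d'_def split: nat.split)
  ultimately show ?case using unitary_mult[OF W P] by blast
qed

subsection \<open>The topology of the unitary groups\<close>

text \<open>For injective \<open>f\<close> the pullback topology is the subspace topology of the
  image carried back to \<open>A\<close>. Separation properties inherited by subspaces of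
  \<open>Y\<close> therefore pass to it.\<close>

lemma embedding_map_pullback_topology:
  assumes inj: "inj_on f A" and sub: "f ` A \<subseteq> topspace Y"
  shows "embedding_map (pullback_topology A f Y) Y f"
  unfolding embedding_map_def
proof (rule bijective_open_imp_homeomorphic_map)
  have top: "topspace (pullback_topology A f Y) = A"
    using sub by (auto simp: topspace_pullback_topology)
  show "continuous_map (pullback_topology A f Y) (subtopology Y (f ` topspace (pullback_topology A f Y))) f"
    using continuous_map_pullback[OF continuous_map_id, of A f Y]
    by (simp add: continuous_map_in_subtopology)
  show "open_map (pullback_topology A f Y) (subtopology Y (f ` topspace (pullback_topology A f Y))) f"
    unfolding open_map_def top openin_pullback_topology openin_subtopology by auto
  show "f ` topspace (pullback_topology A f Y) = topspace (subtopology Y (f ` topspace (pullback_topology A f Y)))"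
    using sub by (auto simp: top)
  show "inj_on f (topspace (pullback_topology A f Y))"
    using inj by (simp add: top)
qed

lemma topspace_unitary_topology [simp]: "topspace (unitary_topology n) = carrier (unitary_group n)"
  by (auto simp: unitary_topology_def topspace_pullback_topology)

lemma embedding_map_unitary_entries:
  "embedding_map (unitary_topology n) (product_topology (\<lambda>_. euclidean) ({..<n} \<times> {..<n}))
     (\<lambda>A. \<lambda>ij\<in>{..<n} \<times> {..<n}. A $$ ij)"
  unfolding unitary_topology_def
proof (rule embedding_map_pullback_topology)
  show "inj_on (\<lambda>A. \<lambda>ij\<in>{..<n} \<times> {..<n}. A $$ ij) (carrier (unitary_group n))"
  proof (rule inj_onI)
    fix A B :: "complex mat"
    assume AB: "A \<in> carrier (unitary_group n)" "B \<in> carrier (unitary_group n)"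
      and eq: "(\<lambda>ij\<in>{..<n} \<times> {..<n}. A $$ ij) = (\<lambda>ij\<in>{..<n} \<times> {..<n}. B $$ ij)"
    have "A $$ (i, j) = B $$ (i, j)" if "i < n" "j < n" for i j
      using fun_cong[OF eq, of "(i, j)"] that by simp
    then show "A = B" using AB[THEN unitary_carrier] by (intro eq_matI) auto
  qed
qed (auto split: if_splits)

text \<open>U(n) embeds in a finite power of the complex plane, and both properties are hereditary.
  They make the product of unitary groups a Tychonoff space, to which an assumption about all free
  actions on Tychonoff spaces can be applied.\<close>

lemma Tychonoff_unitary_topology:
  "completely_regular_space (unitary_topology n)" "Hausdorff_space (unitary_topology n)"
proof -
  let ?Y = "product_topology (\<lambda>_. euclidean :: complex topology) ({..<n} \<times> {..<n})"
  let ?f = "\<lambda>A. \<lambda>ij\<in>{..<n} \<times> {..<n}. A $$ ij"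
  have h: "unitary_topology n homeomorphic_space subtopology ?Y (?f ` topspace (unitary_topology n))"
    using embedding_map_imp_homeomorphic_space[OF embedding_map_unitary_entries] .
  have "completely_regular_space ?Y" "Hausdorff_space ?Y"
    by (auto simp: completely_regular_space_product_topology Hausdorff_space_product_topology
        metrizable_imp_completely_regular_space metrizable_space_euclidean)
  then show "completely_regular_space (unitary_topology n)" "Hausdorff_space (unitary_topology n)"
    using homeomorphic_completely_regular_space[OF h] homeomorphic_Hausdorff_space[OF h]
      completely_regular_space_subtopology Hausdorff_space_subtopology by blast+
qed

text \<open>Continuity into a pullback topology is tested after composition with the defining map,
  and continuity into a product is tested coordinatewise; what remains are the complex-valued matrix
  entries.\<close>

lemma continuous_map_unitary_iff:
  "continuous_map X (unitary_topology n) f \<longleftrightarrow>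
     f \<in> topspace X \<rightarrow> carrier (unitary_group n) \<and>
     (\<forall>i<n. \<forall>j<n. continuous_map X euclidean (\<lambda>x. f x $$ (i, j)))"
  (is "?lhs \<longleftrightarrow> ?rhs")
proof
  let ?g = "\<lambda>A. \<lambda>ij\<in>{..<n} \<times> {..<n}. A $$ ij"
  let ?Y = "product_topology (\<lambda>_. euclidean :: complex topology) ({..<n} \<times> {..<n})"
  assume L: ?lhs
  have "continuous_map (unitary_topology n) ?Y ?g"
    using embedding_map_unitary_entries[of n]
    by (auto simp: embedding_map_def continuous_map_in_subtopology dest: homeomorphic_imp_continuous_map)
  from continuous_map_compose[OF L this]
  have "continuous_map X ?Y (?g \<circ> f)" .
  then have "\<forall>ij\<in>{..<n} \<times> {..<n}. continuous_map X euclidean (\<lambda>x. (?g \<circ> f) x ij)"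
    unfolding continuous_map_componentwise by blast
  then show ?rhs
    using continuous_map_funspace[OF L] by (auto simp: o_def)
next
  assume R: ?rhs
  show ?lhs
    unfolding unitary_topology_def
  proof (rule continuous_map_pullback')
    show "continuous_map X (product_topology (\<lambda>_. euclidean) ({..<n} \<times> {..<n}))
            ((\<lambda>A. \<lambda>ij\<in>{..<n} \<times> {..<n}. A $$ ij) \<circ> f)"
      using R by (auto simp: continuous_map_componentwise o_def)
  qed (use R in auto)
qed

lemma continuous_map_unitary_entry:
  "continuous_map X (unitary_topology n) f \<Longrightarrow> i < n \<Longrightarrow> j < n \<Longrightarrow>
     continuous_map X euclidean (\<lambda>x. f x $$ (i, j))"
  by (simp add: continuous_map_unitary_iff)

lemma continuous_map_complex_mult:
  fixes f g :: "'a \<Rightarrow> complex"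
  shows "continuous_map X euclidean f \<Longrightarrow> continuous_map X euclidean g \<Longrightarrow>
    continuous_map X euclidean (\<lambda>x. f x * g x)"
  by (simp add: continuous_map_atin tendsto_mult)

lemma continuous_map_unitary_mult:
  assumes f: "continuous_map X (unitary_topology n) f" and g: "continuous_map X (unitary_topology n) g"
  shows "continuous_map X (unitary_topology n) (\<lambda>x. f x * g x)"
proof -
  have fg: "f x \<in> carrier (unitary_group n)" "g x \<in> carrier (unitary_group n)" if "x \<in> topspace X" for x
    using f g that by (auto simp: continuous_map_unitary_iff)
  have "continuous_map X euclidean (\<lambda>x. (f x * g x) $$ (i, j))" if ij: "i < n" "j < n" for i j
  proof (rule continuous_map_eq)
    show "continuous_map X euclidean (\<lambda>x. \<Sum>k<n. f x $$ (i, k) * g x $$ (k, j))"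
      using ij by (intro continuous_map_sum continuous_map_complex_mult
          continuous_map_unitary_entry[OF f] continuous_map_unitary_entry[OF g]) auto
    fix x assume "x \<in> topspace X"
    then show "(\<Sum>k<n. f x $$ (i, k) * g x $$ (k, j)) = (f x * g x) $$ (i, j)"
      using index_mult_mat_sum[OF fg(1)[THEN unitary_carrier] fg(2)[THEN unitary_carrier] ij]
      by simp
  qed
  then show ?thesis
    using fg unitary_mult by (auto simp: continuous_map_unitary_iff)
qed

text \<open>A basic open set of the product constrains each of the finitely many entries by an open
  set; all sufficiently small radii work for each entry, so one radius works for all of
  them.\<close>

lemma unitary_entrywise_nbhd:
  assumes V: "openin (unitary_topology n) V" and "A \<in> V"
  obtains e where "e > 0"
    and "\<And>B. B \<in> carrier (unitary_group n) \<Longrightarrow>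
           (\<And>i j. i < n \<Longrightarrow> j < n \<Longrightarrow> cmod (B $$ (i, j) - A $$ (i, j)) < e) \<Longrightarrow> B \<in> V"
proof -
  let ?I = "{..<n} \<times> {..<n}"
  let ?f = "\<lambda>A. \<lambda>ij\<in>?I. A $$ ij"
  obtain U where U: "openin (product_topology (\<lambda>_. euclidean :: complex topology) ?I) U"
    and VU: "V = ?f -` U \<inter> carrier (unitary_group n)"
    using V by (auto simp: unitary_topology_def openin_pullback_topology)
  obtain W where W: "\<forall>ij\<in>?I. open (W ij)" "?f A \<in> Pi\<^sub>E ?I W" "Pi\<^sub>E ?I W \<subseteq> U"
    using U \<open>A \<in> V\<close> unfolding VU openin_product_topology_alt by auto
  have "\<forall>\<^sub>F e in at_right 0. ball (A $$ ij) e \<subseteq> W ij" if ij: "ij \<in> ?I" for ij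
  proof -
    have "A $$ ij \<in> W ij" using W(2) ij by (auto simp: PiE_iff split: if_splits)
    then obtain r where r: "r > 0" "ball (A $$ ij) r \<subseteq> W ij"
      using W(1) ij open_contains_ball by blast
    show ?thesis
      using eventually_at_right_less[of "0::real"] eventually_at_right_real[OF r(1)]
      by eventually_elim (use r(2) in force)
  qed
  then have "\<forall>\<^sub>F e in at_right 0. \<forall>ij\<in>?I. ball (A $$ ij) e \<subseteq> W ij"
    by (intro eventually_ball_finite) auto
  then have "\<forall>\<^sub>F e in at_right 0. e > (0::real) \<and> (\<forall>ij\<in>?I. ball (A $$ ij) e \<subseteq> W ij)"
    using eventually_at_right_less[of "0::real"] by eventually_elim simp
  then obtain e where e: "e > (0::real)" "\<And>ij. ij \<in> ?I \<Longrightarrow> ball (A $$ ij) e \<subseteq> W ij"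
    using eventually_happens' trivial_limit_at_right_real by (metis (mono_tags, lifting))
  show ?thesis
  proof (rule that[OF e(1)])
    fix B assume B: "B \<in> carrier (unitary_group n)"
      and close: "\<And>i j. i < n \<Longrightarrow> j < n \<Longrightarrow> cmod (B $$ (i, j) - A $$ (i, j)) < e"
    have "?f B \<in> Pi\<^sub>E ?I W"
    proof (rule PiE_I)
      fix ij assume ij: "ij \<in> ?I"
      then have "B $$ ij \<in> ball (A $$ ij) e"
        using close by (auto simp: dist_norm norm_minus_commute)
      then show "?f B ij \<in> W ij" using e(2)[OF ij] ij by auto
    qed auto
    then have "?f B \<in> U" using W(3) by blast
    then show "B \<in> V" using B by (simp add: VU)
  qed
qed

section \<open>The Frobenius inner product and paths in U(n)\<close>

text \<open>This is the trace of \<open>mat_adjoint A * B\<close>, conjugate-linear in the first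
  argument.\<close>

definition mat_inner :: "nat \<Rightarrow> complex mat \<Rightarrow> complex mat \<Rightarrow> complex" where
  "mat_inner n A B = (\<Sum>i<n. \<Sum>j<n. cnj (A $$ (i, j)) * B $$ (i, j))"

text \<open>Since \<open>mat_adjoint A * A\<close> is the identity, what remains is the trace of
  \<open>M\<close>. Writing a unitary matrix as \<open>A * M\<close> thus makes its inner product
  with \<open>A\<close> depend only on the eigenvalues of \<open>M\<close>.\<close>

lemma mat_inner_mult:
  assumes A: "A \<in> carrier (unitary_group n)" and M: "M \<in> carrier_mat n n"
  shows "mat_inner n A (A * M) = (\<Sum>j<n. M $$ (j, j))"
proof -
  have "mat_inner n A (A * M) = (\<Sum>i<n. \<Sum>j<n. \<Sum>l<n. cnj (A $$ (i, j)) * A $$ (i, l) * M $$ (l, j))"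
    unfolding mat_inner_def
    by (intro sum.cong refl)
       (simp add: index_mult_mat_sum[OF unitary_carrier[OF A] M] sum_distrib_left mult.assoc
         del: index_mult_mat(1))
  also have "\<dots> = (\<Sum>j<n. \<Sum>i<n. \<Sum>l<n. cnj (A $$ (i, j)) * A $$ (i, l) * M $$ (l, j))"
    by (rule sum.swap)
  also have "\<dots> = (\<Sum>j<n. \<Sum>l<n. \<Sum>i<n. cnj (A $$ (i, j)) * A $$ (i, l) * M $$ (l, j))"
    by (intro sum.cong refl sum.swap)
  also have "\<dots> = (\<Sum>j<n. \<Sum>l<n. (if j = l then 1 else 0) * M $$ (l, j))"
    by (intro sum.cong refl) (simp add: unitary_cols[OF A] flip: sum_distrib_right)
  also have "\<dots> = (\<Sum>j<n. M $$ (j, j))"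
    by (intro sum.cong refl) (simp add: if_distrib[of "\<lambda>x. x * _"] cong: if_cong)
  finally show ?thesis .
qed

text \<open>Each of the \<open>n\<close> rows has length 1. All of U(n) thus lies on one Frobenius
  sphere, where distance from a fixed matrix is a decreasing function of the real part of the inner
  product with it.\<close>

lemma unitary_frobenius:
  assumes "A \<in> carrier (unitary_group n)"
  shows "(\<Sum>i<n. \<Sum>j<n. (cmod (A $$ (i, j)))\<^sup>2) = n"
proof -
  have "(\<Sum>j<n. (cmod (A $$ (i, j)))\<^sup>2) = 1" if "i < n" for i
  proof -
    have "complex_of_real (\<Sum>j<n. (cmod (A $$ (i, j)))\<^sup>2) = of_real 1"
      using unitary_rows[OF assms that that] by (simp only: of_real_sum complex_norm_square) simp
    then show ?thesis by (simp only: of_real_eq_iff)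
  qed
  then show ?thesis by simp
qed

text \<open>The right-hand side is exactly the squared Frobenius distance of \<open>A\<close> and
  \<open>B\<close>, expanded as \<open>n + n - 2 * Re (mat_inner n A B)\<close>; a single entry
  contributes at most the whole sum.\<close>

lemma unitary_dist_le:
  assumes A: "A \<in> carrier (unitary_group n)" and B: "B \<in> carrier (unitary_group n)"
    and ij: "i < n" "j < n"
  shows "(cmod (B $$ (i, j) - A $$ (i, j)))\<^sup>2 \<le> 2 * (n - Re (mat_inner n A B))"
proof -
  have *: "(cmod (b - a))\<^sup>2 = (cmod b)\<^sup>2 + (cmod a)\<^sup>2 - 2 * Re (cnj a * b)" for a b
    unfolding cmod_power2 by (simp add: power2_eq_square algebra_simps)
  have "(cmod (B $$ (i, j) - A $$ (i, j)))\<^sup>2 \<le> (\<Sum>l<n. (cmod (B $$ (i, l) - A $$ (i, l)))\<^sup>2)"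
    using ij by (intro member_le_sum) auto
  also have "\<dots> \<le> (\<Sum>k<n. \<Sum>l<n. (cmod (B $$ (k, l) - A $$ (k, l)))\<^sup>2)"
    using ij by (intro member_le_sum[where f = "\<lambda>k. \<Sum>l<n. (cmod (B $$ (k, l) - A $$ (k, l)))\<^sup>2"] sum_nonneg) auto
  also have "\<dots> = 2 * (n - Re (mat_inner n A B))"
    unfolding * sum.distrib sum_subtractf unitary_frobenius[OF A] unitary_frobenius[OF B]
    by (simp add: mat_inner_def sum_distrib_left)
  finally show ?thesis .
qed

lemma diag_of_unitary:
  assumes "\<And>k. k < n \<Longrightarrow> cmod (d k) = 1"
  shows "diag_of n d \<in> carrier (unitary_group n)"
proof (rule unitary_if_orthonormal_rows)
  fix i j assume ij: "i < n" "j < n"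
  have "(\<Sum>k<n. diag_of n d $$ (i, k) * cnj (diag_of n d $$ (j, k))) =
        (\<Sum>k<n. if i = k then (if i = j then d i * cnj (d i) else 0) else 0)"
    using ij by (intro sum.cong) (auto simp: diag_of_def)
  also have "\<dots> = (if i = j then 1 else 0)"
    using ij assms[of i] complex_norm_square[of "d i"] by auto
  finally show "(\<Sum>k<n. diag_of n d $$ (i, k) * cnj (diag_of n d $$ (j, k))) = (if i = j then 1 else 0)" .
qed simp

text \<open>With \<open>A\<^sup>* B = P diag(exp(i \<theta>\<^sub>k)) P\<^sup>*\<close> and \<open>\<bar>\<theta>\<^sub>k\<bar> \<le> \<pi>\<close>, the path is
  \<open>\<gamma>(t) = A P diag(exp(i t \<theta>\<^sub>k)) P\<^sup>*\<close>, for which the inner product with \<open>A\<close> has real part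
  \<open>\<Sum> cos (t \<theta>\<^sub>k)\<close>, decreasing in \<open>t\<close>: the path never leaves a Frobenius ball around \<open>A\<close>
  that contains \<open>B\<close>.\<close>

lemma unitary_path:
  assumes A: "A \<in> carrier (unitary_group n)" and B: "B \<in> carrier (unitary_group n)"
  obtains \<gamma> where "pathin (unitary_topology n) \<gamma>" "\<gamma> 0 = A" "\<gamma> 1 = B"
    "\<And>t. t \<in> {0..1} \<Longrightarrow> Re (mat_inner n A B) \<le> Re (mat_inner n A (\<gamma> t))"
proof -
  obtain P d where P: "P \<in> carrier (unitary_group n)" and d: "\<And>k. k < n \<Longrightarrow> cmod (d k) = 1"
    and AB: "mat_adjoint A * B = P * diag_of n d * mat_adjoint P"
    using unitary_diagonalizable[OF unitary_mult[OF unitary_adjoint[OF A] B]] by blast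
  note Ac = unitary_carrier[OF A] and Bc = unitary_carrier[OF B] and Pc = unitary_carrier[OF P]
  define D where "D t = diag_of n (\<lambda>k. cis (t * Arg (d k)))" for t
  define M where "M t = P * D t * mat_adjoint P" for t
  define \<gamma> where "\<gamma> t = A * M t" for t
  have D: "D t \<in> carrier (unitary_group n)" for t
    unfolding D_def by (rule diag_of_unitary) simp
  have M: "M t \<in> carrier (unitary_group n)" for t
    unfolding M_def by (intro unitary_mult unitary_adjoint P D)
  have contD: "continuous_map (top_of_set {0..1}) (unitary_topology n) D"
    unfolding continuous_map_unitary_iff
    using D by (auto simp: D_def diag_of_def intro!: continuous_intros)
  have const: "C \<in> carrier (unitary_group n) \<Longrightarrow> continuous_map X (unitary_topology n) (\<lambda>_. C)"
    for C :: "complex mat" and X :: "real topology"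
    by simp
  have path: "pathin (unitary_topology n) \<gamma>"
    unfolding pathin_def \<gamma>_def M_def
    by (intro continuous_map_unitary_mult const contD A P unitary_adjoint)
  have "D 0 = 1\<^sub>m n" by (rule eq_matI) (auto simp: D_def diag_of_def)
  then have "\<gamma> 0 = A"
    unfolding \<gamma>_def M_def using Pc Ac unitary_mult_adjoint[OF P] by simp
  moreover have \<gamma>1: "\<gamma> 1 = B"
  proof -
    have "cis (Arg (d k)) = d k" if "k < n" for k
      using d[OF that] by (subst cis_Arg) (auto simp: sgn_div_norm)
    then have "D 1 = diag_of n d" by (intro eq_matI) (auto simp: D_def diag_of_def)
    then have "\<gamma> 1 = A * (mat_adjoint A * B)" by (simp add: \<gamma>_def M_def AB)
    also have "\<dots> = (A * mat_adjoint A) * B"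
      using assoc_mult_mat[OF Ac mat_adjoint_carrier[OF Ac] Bc] by simp
    finally show ?thesis using unitary_mult_adjoint[OF A] Bc by simp
  qed
  moreover have inner: "Re (mat_inner n A (\<gamma> t)) = (\<Sum>k<n. cos (t * Arg (d k)))" for t
  proof -
    have "mat_inner n A (\<gamma> t) = (\<Sum>j<n. M t $$ (j, j))"
      unfolding \<gamma>_def by (rule mat_inner_mult[OF A unitary_carrier[OF M]])
    also have "\<dots> = (\<Sum>j<n. \<Sum>k<n. P $$ (j, k) * cis (t * Arg (d k)) * cnj (P $$ (j, k)))"
      unfolding M_def D_def by (intro sum.cong refl) (simp only: index_conj_diag[OF Pc] lessThan_iff)
    also have "\<dots> = (\<Sum>k<n. \<Sum>j<n. P $$ (j, k) * cis (t * Arg (d k)) * cnj (P $$ (j, k)))"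
      by (rule sum.swap)
    \<comment> \<open>This is invariance of the trace under conjugation by \<open>P\<close>: the
      inner sum is the squared length of column \<open>k\<close> of \<open>P\<close>, which is
      1.\<close>
    also have "\<dots> = (\<Sum>k<n. cis (t * Arg (d k)) * (\<Sum>j<n. cnj (P $$ (j, k)) * P $$ (j, k)))"
      by (simp add: sum_distrib_left mult_ac)
    also have "\<dots> = (\<Sum>k<n. cis (t * Arg (d k)))"
      by (intro sum.cong refl) (simp add: unitary_cols[OF P])
    finally show ?thesis by simp
  qed
  moreover have "cos (Arg (d k)) \<le> cos (t * Arg (d k))" if "t \<in> {0..1}" for t k
  proof -
    \<comment> \<open>Cosine is even and decreasing on the interval from 0 to \<open>pi\<close>, so
      shrinking the absolute value of the angle can only increase it. The choice of the principal
      argument is what keeps the angle in that interval.\<close>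
    have "cos \<bar>Arg (d k)\<bar> \<le> cos \<bar>t * Arg (d k)\<bar>"
    proof (rule cos_monotone_0_pi_le)
      show "\<bar>t * Arg (d k)\<bar> \<le> \<bar>Arg (d k)\<bar>"
        using that by (simp add: abs_mult mult_left_le_one_le)
      show "\<bar>Arg (d k)\<bar> \<le> pi" using Arg_bounded[of "d k"] by auto
    qed simp
    then show ?thesis by simp
  qed
  then have "Re (mat_inner n A B) \<le> Re (mat_inner n A (\<gamma> t))" if "t \<in> {0..1}" for t
    using inner[of 1] inner[of t] that unfolding \<gamma>1 by (simp add: sum_mono)
  ultimately show ?thesis using that path by blast
qed

lemma path_connected_unitary_topology: "path_connected_space (unitary_topology n)"
  unfolding path_connected_space_def topspace_unitary_topology
  by (meson unitary_path)

text \<open>In the im kleinen form, it suffices to find inside \<open>V\<close> an open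
  \<open>U\<close> around \<open>A\<close> such that every point of \<open>U\<close> is joined to
  \<open>A\<close> within \<open>V\<close>. A small Frobenius ball serves as \<open>U\<close>, since
  the path to each of its points never leaves it.\<close>

lemma locally_path_connected_unitary_topology: "locally_path_connected_space (unitary_topology n)"
  unfolding locally_path_connected_space_im_kleinen
proof (intro allI impI, elim conjE)
  fix V A assume V: "openin (unitary_topology n) V" and AV: "A \<in> V"
  have A: "A \<in> carrier (unitary_group n)" using openin_subset[OF V] AV by auto
  obtain e where e: "e > 0" "\<And>B. B \<in> carrier (unitary_group n) \<Longrightarrow>
     (\<And>i j. i < n \<Longrightarrow> j < n \<Longrightarrow> cmod (B $$ (i, j) - A $$ (i, j)) < e) \<Longrightarrow> B \<in> V"
    using unitary_entrywise_nbhd[OF V AV] by blast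
  \<comment> \<open>On U(n) this is the Frobenius ball of radius \<open>e\<close> around
    \<open>A\<close>: the condition says
    \<open>2 * (n - Re (mat_inner n A B)) < e\<^sup>2\<close>.\<close>
  define U where "U = {B \<in> topspace (unitary_topology n). Re (mat_inner n A B) \<in> {n - e\<^sup>2 / 2<..}}"
  have cont: "continuous_map (unitary_topology n) euclidean (\<lambda>B. Re (mat_inner n A B))"
  proof -
    have "continuous_map (unitary_topology n) euclidean (mat_inner n A)"
      unfolding mat_inner_def
      using continuous_map_unitary_entry[OF continuous_map_id, unfolded id_def]
      by (intro continuous_map_sum continuous_map_complex_mult) auto
    then have "continuous_map (unitary_topology n) euclidean (Re \<circ> mat_inner n A)"
      by (rule continuous_map_compose) (simp add: continuous_on_Re)
    then show ?thesis by (simp add: o_def)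
  qed
  have "openin (unitary_topology n) U"
    unfolding U_def by (rule openin_continuous_map_preimage[OF cont]) simp
  moreover have "A \<in> U"
    using mat_inner_mult[OF A one_carrier_mat] A e(1) unitary_carrier[OF A] by (simp add: U_def)
  moreover have UV: "U \<subseteq> V"
  proof
    fix B assume "B \<in> U"
    then have B: "B \<in> carrier (unitary_group n)" and lt: "2 * (n - Re (mat_inner n A B)) < e\<^sup>2"
      by (auto simp: U_def)
    show "B \<in> V"
    proof (rule e(2)[OF B])
      fix i j assume "i < n" "j < n"
      from unitary_dist_le[OF A B this] lt
      have "(cmod (B $$ (i, j) - A $$ (i, j)))\<^sup>2 < e\<^sup>2" by linarith
      then show "cmod (B $$ (i, j) - A $$ (i, j)) < e" using e(1) by (simp add: power_less_imp_less_base)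
    qed
  qed
  moreover have "\<exists>C. path_connectedin (unitary_topology n) C \<and> C \<subseteq> V \<and> A \<in> C \<and> B \<in> C"
    if BU: "B \<in> U" for B
  proof -
    have B: "B \<in> carrier (unitary_group n)" using BU by (simp add: U_def)
    obtain \<gamma> where \<gamma>: "pathin (unitary_topology n) \<gamma>" "\<gamma> 0 = A" "\<gamma> 1 = B"
      "\<And>t. t \<in> {0..1} \<Longrightarrow> Re (mat_inner n A B) \<le> Re (mat_inner n A (\<gamma> t))"
      using unitary_path[OF A B] by blast
    have "\<gamma> ` {0..1} \<subseteq> U"
    proof
      fix C assume "C \<in> \<gamma> ` {0..1}"
      then obtain t where t: "t \<in> {0..1}" "C = \<gamma> t" by blast
      then have "C \<in> carrier (unitary_group n)"
        using path_image_subset_topspace[OF \<gamma>(1)] by auto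
      then show "C \<in> U" using BU \<gamma>(4)[OF t(1)] t(2) by (auto simp: U_def)
    qed
    moreover have "A \<in> \<gamma> ` {0..1}" "B \<in> \<gamma> ` {0..1}"
      using \<gamma>(2,3) by force+
    ultimately show ?thesis
      using path_connectedin_path_image[OF \<gamma>(1)] UV by blast
  qed
  ultimately show "\<exists>U. openin (unitary_topology n) U \<and> A \<in> U \<and> U \<subseteq> V \<and>
     (\<forall>B\<in>U. \<exists>C. path_connectedin (unitary_topology n) C \<and> C \<subseteq> V \<and> A \<in> C \<and> B \<in> C)"
    by blast
qed

subsection \<open>The translation action on the product of unitary groups\<close>

lemma topspace_unitary_product_topology:
  "topspace (unitary_product_topology R) = carrier (unitary_product_group R)"
  by (simp add: unitary_product_topology_def unitary_product_group_def)

lemma group_unitary_product_group: "group (unitary_product_group R)"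
  by (simp add: unitary_product_group_def group_unitary_group)

lemma locally_path_connected_unitary_product_topology:
  "locally_path_connected_space (unitary_product_topology R)"
  by (simp add: unitary_product_topology_def locally_path_connected_space_product_topology
      path_connected_unitary_topology locally_path_connected_unitary_topology)

lemma Tychonoff_unitary_product_topology: "Tychonoff_space (unitary_product_topology R)"
  by (simp add: Tychonoff_space_def unitary_product_topology_def
      completely_regular_space_product_topology Hausdorff_space_product_topology
      Tychonoff_unitary_topology)

lemma group_action_left_translation:
  assumes "group_hom G K f"
  shows "group_action G (carrier K) (\<lambda>g. \<lambda>x\<in>carrier K. f g \<otimes>\<^bsub>K\<^esub> x)"
proof -
  interpret group_hom G K f by fact
  have bij: "(\<lambda>x\<in>carrier K. k \<otimes>\<^bsub>K\<^esub> x) \<in> Bij (carrier K)" if k: "k \<in> carrier K" for k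
  proof -
    have "bij_betw (\<lambda>x\<in>carrier K. k \<otimes>\<^bsub>K\<^esub> x) (carrier K) (carrier K)"
    proof (rule bij_betw_byWitness[where f' = "\<lambda>x. inv\<^bsub>K\<^esub> k \<otimes>\<^bsub>K\<^esub> x"])
      show "\<forall>x\<in>carrier K. inv\<^bsub>K\<^esub> k \<otimes>\<^bsub>K\<^esub> restrict (\<lambda>x. k \<otimes>\<^bsub>K\<^esub> x) (carrier K) x = x"
        using k by (simp add: H.m_assoc[symmetric])
      show "\<forall>x\<in>carrier K. restrict (\<lambda>x. k \<otimes>\<^bsub>K\<^esub> x) (carrier K) (inv\<^bsub>K\<^esub> k \<otimes>\<^bsub>K\<^esub> x) = x"
        using k by (simp add: H.m_assoc[symmetric])
    qed (use k in auto)
    then show ?thesis by (simp add: Bij_def)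
  qed
  have "(\<lambda>g. \<lambda>x\<in>carrier K. f g \<otimes>\<^bsub>K\<^esub> x) \<in> hom G (BijGroup (carrier K))"
  proof (rule homI)
    fix g h assume gh: "g \<in> carrier G" "h \<in> carrier G"
    show "(\<lambda>x\<in>carrier K. f g \<otimes>\<^bsub>K\<^esub> x) \<in> carrier (BijGroup (carrier K))"
      using gh bij by (simp add: BijGroup_def)
    show "(\<lambda>x\<in>carrier K. f (g \<otimes>\<^bsub>G\<^esub> h) \<otimes>\<^bsub>K\<^esub> x) =
        (\<lambda>x\<in>carrier K. f g \<otimes>\<^bsub>K\<^esub> x) \<otimes>\<^bsub>BijGroup (carrier K)\<^esub> (\<lambda>x\<in>carrier K. f h \<otimes>\<^bsub>K\<^esub> x)"
      using gh bij by (auto simp: BijGroup_def compose_def H.m_assoc intro!: restrict_ext)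
  qed
  then show ?thesis
    by (intro group_action.intro group_hom.intro group_hom_axioms.intro group_BijGroup) simp_all
qed

context
  fixes G :: "('a, 'm) monoid_scheme" and T :: "'a topology" and R :: "'a unitary_rep set"
  assumes G: "topological_group G T" and R: "\<forall>r\<in>R. unitary_representation G T r"
begin

lemma group_hom_can_map: "group_hom G (unitary_product_group R) (can_map R)"
proof (intro group_hom.intro group_hom_axioms.intro group_unitary_product_group homI)
  show "group G" using G by (simp add: topological_group_def)
  have hom: "snd r \<in> hom G (unitary_group (fst r))" if "r \<in> R" for r
    using R that by (auto simp: unitary_representation_def split: prod.splits)
  fix g h assume gh: "g \<in> carrier G" "h \<in> carrier G"
  show "can_map R g \<in> carrier (unitary_product_group R)"
    using hom_in_carrier[OF hom] gh by (auto simp: can_map_def unitary_product_group_def)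
  show "can_map R (g \<otimes>\<^bsub>G\<^esub> h) = can_map R g \<otimes>\<^bsub>unitary_product_group R\<^esub> can_map R h"
    using hom_mult[OF hom] gh by (auto simp: can_map_def unitary_product_group_def intro!: restrict_ext)
qed

lemma continuous_action_can_action:
  "continuous_action G T (unitary_product_topology R) (can_action R)"
  unfolding continuous_action_def
proof
  have "can_action R =
      (\<lambda>g. \<lambda>x\<in>carrier (unitary_product_group R). can_map R g \<otimes>\<^bsub>unitary_product_group R\<^esub> x)"
    by (simp add: can_action_def topspace_unitary_product_topology fun_eq_iff)
  then show "group_action G (topspace (unitary_product_topology R)) (can_action R)"
    using group_action_left_translation[OF group_hom_can_map]
    by (simp add: topspace_unitary_product_topology)
next
  let ?P = "unitary_product_topology R"
  show "continuous_map (prod_topology T ?P) ?P (\<lambda>(g, x). can_action R g x)"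
  proof (rule continuous_map_eq)
    fix z assume "z \<in> topspace (prod_topology T ?P)"
    then show "(\<lambda>r\<in>R. snd r (fst z) * snd z r) = (case z of (g, x) \<Rightarrow> can_action R g x)"
      by (auto simp: can_action_def can_map_def unitary_product_group_def unitary_group_simps
          split: prod.splits intro!: restrict_ext)
  next
    have "continuous_map (prod_topology T ?P) (unitary_topology (fst r)) (\<lambda>z. snd r (fst z) * snd z r)"
      if r: "r \<in> R" for r
    proof (rule continuous_map_unitary_mult)
      have "continuous_map T (unitary_topology (fst r)) (snd r)"
        using R r by (auto simp: unitary_representation_def split: prod.splits)
      from continuous_map_compose[OF continuous_map_fst this]
      show "continuous_map (prod_topology T ?P) (unitary_topology (fst r)) (\<lambda>z. snd r (fst z))"
        by (simp add: o_def)
      have "continuous_map ?P (unitary_topology (fst r)) (\<lambda>x. x r)"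
        unfolding unitary_product_topology_def by (rule continuous_map_product_projection[OF r])
      from continuous_map_compose[OF continuous_map_snd this]
      show "continuous_map (prod_topology T ?P) (unitary_topology (fst r)) (\<lambda>z. snd z r)"
        by (simp add: o_def)
    qed
    then show "continuous_map (prod_topology T ?P) ?P (\<lambda>z. \<lambda>r\<in>R. snd r (fst z) * snd z r)"
      unfolding unitary_product_topology_def continuous_map_componentwise by auto
  qed
qed

text \<open>If \<open>g\<close> fixes some \<open>x\<close>, cancelling \<open>x\<close> in the
  product group leaves \<open>can_map R g\<close> equal to the unit. Every stabilizer is thus the
  kernel of \<open>can_map R\<close>.\<close>

lemma free_action_can_action:
  assumes inj: "inj_on (can_map R) (carrier G)"
  shows "free_action G (unitary_product_topology R) (can_action R)"
  unfolding free_action_def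
proof
  interpret group_hom G "unitary_product_group R" "can_map R" by (rule group_hom_can_map)
  fix x assume "x \<in> topspace (unitary_product_topology R)"
  then have x: "x \<in> carrier (unitary_product_group R)"
    by (simp add: topspace_unitary_product_topology)
  have "can_action R g x = x \<longleftrightarrow> g = \<one>\<^bsub>G\<^esub>" if g: "g \<in> carrier G" for g
  proof -
    have "can_action R g x = x \<longleftrightarrow> can_map R g = \<one>\<^bsub>unitary_product_group R\<^esub>"
      using x g H.r_cancel_one[of x "can_map R g"]
      by (simp add: can_action_def topspace_unitary_product_topology)
    also have "\<dots> \<longleftrightarrow> can_map R g = can_map R \<one>\<^bsub>G\<^esub>" by simp
    also have "\<dots> \<longleftrightarrow> g = \<one>\<^bsub>G\<^esub>" using inj_on_eq_iff[OF inj g G.one_closed] .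
    finally show ?thesis .
  qed
  then show "stabilizer G (can_action R) x = {\<one>\<^bsub>G\<^esub>}"
    by (auto simp: stabilizer_def)
qed

end

section \<open>From a locally trivial action to its structure group\<close>

lemma locally_path_connected_structure_group:
  assumes triv: "locally_trivial_action G T X \<phi>"
    and X: "locally_path_connected_space X" "topspace X \<noteq> {}" and T: "topspace T \<noteq> {}"
  shows "locally_path_connected_space T"
proof -
  let ?Q = "orbit_space G X \<phi>"
  \<comment> \<open>The underlying set of \<open>orbit_space\<close> is the union of its open sets,
    so that every orbit is a point of it has to be derived: the preimage of the set of all orbits is
    the whole of \<open>X\<close>.\<close>
  have "openin ?Q (orbits G (topspace X) \<phi>)"
    by (auto simp: openin_orbit_space orbits_def intro: openin_subopen[THEN iffD2])
  then have orbits: "orbits G (topspace X) \<phi> \<subseteq> topspace ?Q" by (rule openin_subset)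
  obtain x where x: "x \<in> topspace X" using X(2) by blast
  then have "orbit G \<phi> x \<in> topspace ?Q" using orbits by (auto simp: orbits_def)
  then obtain U h where U: "openin ?Q U" "orbit G \<phi> x \<in> U"
    and h: "homeomorphic_map (subtopology X {x \<in> topspace X. orbit G \<phi> x \<in> U})
              (prod_topology T (subtopology ?Q U)) h"
    using triv unfolding locally_trivial_action_def Let_def by meson
  have "locally_path_connected_space (subtopology X {x \<in> topspace X. orbit G \<phi> x \<in> U})"
    using U(1) X(1) by (intro locally_path_connected_space_open_subset) (auto simp: openin_orbit_space)
  then have "locally_path_connected_space (prod_topology T (subtopology ?Q U))"
    using homeomorphic_locally_path_connected_space[OF homeomorphic_map_imp_homeomorphic_space[OF h]]
    by blast
  \<comment> \<open>An empty product would carry no information about its factor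
    \<open>T\<close>.\<close>
  moreover have "topspace (prod_topology T (subtopology ?Q U)) \<noteq> {}"
    using T U openin_subset[OF U(1)] by auto
  ultimately show ?thesis
    by (metis locally_path_connected_space_prod_topology null_topspace_iff_trivial)
qed

lemma finite_path_components_of_compact:
  assumes "compact_space X" "locally_path_connected_space X"
  shows "finite (path_components_of X)"
proof -
  have "\<forall>C\<in>path_components_of X. openin X C"
    using openin_path_components_of_locally_path_connected_space[OF assms(2)] by blast
  then obtain \<F> where \<F>: "finite \<F>" "\<F> \<subseteq> path_components_of X" "topspace X \<subseteq> \<Union>\<F>"
    using assms(1) Union_path_components_of[of X] unfolding compact_space_alt by (metis subset_refl)
  \<comment> \<open>The components are nonempty and pairwise disjoint, so no member of this open
    cover can be omitted: the finite subcover is the whole cover.\<close>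
  have "path_components_of X \<subseteq> \<F>"
  proof
    fix C assume C: "C \<in> path_components_of X"
    then obtain x where x: "x \<in> C" using nonempty_path_components_of by blast
    then obtain D where D: "D \<in> \<F>" "x \<in> D"
      using \<F>(3) path_components_of_subset[OF C] by blast
    then have "C = D"
      using pairwise_disjoint_path_components_of[of X] C \<F>(2) x
      by (auto simp: pairwise_def disjnt_iff)
    with D show "C \<in> \<F>" by simp
  qed
  then show ?thesis using \<F>(1) finite_subset by blast
qed

section \<open>Path components as cosets\<close>

text \<open>Right translations are continuous, so they carry paths to paths. Translating by
  \<open>a\<close> gives one inclusion, translating back by the inverse of \<open>a\<close> the
  other.\<close>

lemma path_component_translate:
  assumes G: "topological_group G T" and a: "a \<in> carrier G"
  shows "path_component_of_set T \<one>\<^bsub>G\<^esub> #>\<^bsub>G\<^esub> a = path_component_of_set T a"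
proof -
  interpret group G using G by (simp add: topological_group_def)
  have top: "topspace T = carrier G" using G by (simp add: topological_group_def)
  have trans: "path_component_of T (x \<otimes>\<^bsub>G\<^esub> b) (y \<otimes>\<^bsub>G\<^esub> b)"
    if "path_component_of T x y" and b: "b \<in> carrier G" for x y b
  proof (rule path_component_of_continuous_image[OF _ that(1)])
    have "continuous_map T (prod_topology T T) (\<lambda>x. (x, b))"
      using b by (auto simp: continuous_map_pairwise o_def top)
    moreover have "continuous_map (prod_topology T T) T (\<lambda>(x, y). x \<otimes>\<^bsub>G\<^esub> y)"
      using G by (simp add: topological_group_def)
    ultimately show "continuous_map T T (\<lambda>x. x \<otimes>\<^bsub>G\<^esub> b)"
      using continuous_map_compose by (fastforce simp: o_def)
  qed
  show ?thesis
  proof (intro equalityI subsetI)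
    fix y assume "y \<in> path_component_of_set T \<one>\<^bsub>G\<^esub> #>\<^bsub>G\<^esub> a"
    then obtain x where "path_component_of T \<one>\<^bsub>G\<^esub> x" "y = x \<otimes>\<^bsub>G\<^esub> a"
      by (auto simp: r_coset_def)
    then show "y \<in> path_component_of_set T a" using trans[of "\<one>\<^bsub>G\<^esub>" x a] a by simp
  next
    fix y assume y: "y \<in> path_component_of_set T a"
    then have yG: "y \<in> carrier G"
      using path_component_of_subset_topspace[of T a] by (auto simp: top)
    have "path_component_of T \<one>\<^bsub>G\<^esub> (y \<otimes>\<^bsub>G\<^esub> inv\<^bsub>G\<^esub> a)"
      using trans[of a y "inv\<^bsub>G\<^esub> a"] y a by simp
    moreover have "y = y \<otimes>\<^bsub>G\<^esub> inv\<^bsub>G\<^esub> a \<otimes>\<^bsub>G\<^esub> a" using yG a by (simp add: m_assoc)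
    ultimately show "y \<in> path_component_of_set T \<one>\<^bsub>G\<^esub> #>\<^bsub>G\<^esub> a"
      unfolding r_coset_def by blast
  qed
qed

text \<open>Both sides multiply by \<open>set_mult\<close> and have the path component of the
  identity as unit, so once cosets and path components agree the two structures are literally equal,
  not merely isomorphic.\<close>

lemma FactGroup_path_component_eq_pi0_group:
  assumes G: "topological_group G T"
  shows "G Mod path_component_of_set T \<one>\<^bsub>G\<^esub> = pi0_group G T"
proof -
  have "topspace T = carrier G" using G by (simp add: topological_group_def)
  then have "rcosets\<^bsub>G\<^esub> path_component_of_set T \<one>\<^bsub>G\<^esub> = path_components_of T"
    using path_component_translate[OF G] by (auto simp: RCOSETS_def path_components_of_def)
  then show ?thesis by (simp add: FactGroup_def pi0_group_def)
qed

text \<open>The second conjunct renders the parenthetical remark of the English statement.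
  Injectivity of \<open>can_map R\<close> says there that the canonical map is an embedding, which
  is the content of the Peter-Weyl theorem, and it makes the translation action free. The spaces
  \<open>X\<close> range over topologies on the type of the product, since a formula cannot quantify
  over types.\<close>

theorem proposition1p4:
  fixes G :: "('a, 'm) monoid_scheme"
    and T :: "'a topology"
    and R :: "'a unitary_rep set"
  assumes "compact_group G T"
    and "irrep_representatives G T R"
  defines "G\<^sub>0 \<equiv> identity_component G T"
  shows
    "(principal_action G T (unitary_product_topology R) (can_action R) \<longrightarrow>
        finite (carrier (G Mod G\<^sub>0)) \<and>
        finite (carrier (pi0_group G T)) \<and>
        G Mod G\<^sub>0 = pi0_group G T \<and>
        path_connectedin T G\<^sub>0 \<and>
        locally_connected_space T \<and>
        locally_path_connected_space T \<and>
        locally_connected_space (subtopology T G\<^sub>0) \<and>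
        locally_path_connected_space (subtopology T G\<^sub>0))
     \<and>
     (inj_on (can_map R) (carrier G) \<and>
      (\<forall>(X :: ('a unitary_rep \<Rightarrow> complex mat) topology) \<phi>.
          Tychonoff_space X \<and> continuous_action G T X \<phi> \<and> free_action G X \<phi> \<longrightarrow>
          principal_action G T X \<phi>) \<longrightarrow>
      principal_action G T (unitary_product_topology R) (can_action R))"
proof (intro conjI impI)
  have G: "topological_group G T" and compact: "compact_space T"
    using assms(1) by (simp_all add: compact_group_def)
  {
    assume "principal_action G T (unitary_product_topology R) (can_action R)"
    then have "locally_trivial_action G T (unitary_product_topology R) (can_action R)"
      by (simp add: principal_action_def)
    moreover have "topspace (unitary_product_topology R) \<noteq> {}" "topspace T \<noteq> {}"
      using group.is_monoid[THEN monoid.one_closed] group_unitary_product_group G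
      by (auto simp: topspace_unitary_product_topology topological_group_def)
    ultimately show lpc: "locally_path_connected_space T"
      using locally_path_connected_structure_group locally_path_connected_unitary_product_topology
      by blast
    have G0: "G\<^sub>0 = path_component_of_set T \<one>\<^bsub>G\<^esub>"
      by (simp add: G\<^sub>0_def identity_component_def path_component_eq_connected_component_of[OF lpc])
    show fin: "finite (carrier (pi0_group G T))"
      using finite_path_components_of_compact[OF compact lpc] by (simp add: pi0_group_def)
    show eq: "G Mod G\<^sub>0 = pi0_group G T"
      unfolding G0 by (rule FactGroup_path_component_eq_pi0_group[OF G])
    show "finite (carrier (G Mod G\<^sub>0))" using fin eq by simp
    show "path_connectedin T G\<^sub>0"
      unfolding G0 by (rule path_connectedin_path_component_of)
    show "locally_connected_space T"
      by (rule locally_path_connected_imp_locally_connected_space[OF lpc])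
    \<comment> \<open>The path component of the identity is open, and local path-connectedness
      passes to open subspaces.\<close>
    show "locally_path_connected_space (subtopology T G\<^sub>0)"
      unfolding G0 using lpc
      by (intro locally_path_connected_space_open_subset
          openin_path_component_of_locally_path_connected_space)
    then show "locally_connected_space (subtopology T G\<^sub>0)"
      by (rule locally_path_connected_imp_locally_connected_space)
  }
  have rep: "\<forall>r\<in>R. unitary_representation G T r"
    using assms(2) by (simp add: irrep_representatives_def irreducible_unitary_representation_def)
  assume "inj_on (can_map R) (carrier G) \<and>
      (\<forall>(X :: ('a unitary_rep \<Rightarrow> complex mat) topology) \<phi>.
          Tychonoff_space X \<and> continuous_action G T X \<phi> \<and> free_action G X \<phi> \<longrightarrow>
          principal_action G T X \<phi>)"
  then show "principal_action G T (unitary_product_topology R) (can_action R)"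
    using Tychonoff_unitary_product_topology continuous_action_can_action[OF G rep]
      free_action_can_action[OF G rep] by blast
qed

end
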